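(* Let $s\in(0,1)$, $h>0$ and $N\in\mathbb{N}$. Let $X\subset A_h^N$ be a finite set of cardinality $M\le 2N+1$. If $M\le N$, then there exists a non-zero bounded function $u=\{u_j\}_{j=-N}^N$ on $A_h^N$ such that $u_j=0=(-\Delta_{A_h^N})^su_j$ for all $j\in\{-N,\dots,N\}$ with $hj\in X$.
   Context: The one-dimensional discrete torus is $A_h^N=h\{-N,\dots,N\}$, regarded as the group $h\mathbb{Z}_{2N+1}$, and $u_j:=u(hj)$. Its fractional Laplacian is $$(-\Delta_{A_{h}^N})^s u_j=\sum_{k=-N}^{N}\Big(\frac4{h^2}\sin^2\Big(\frac{k\pi}{2N+1}\Big)\Big)^s c_k(u)\,e^{ik\frac{2\pi j}{2N+1}},\qquad c_k(u)=\frac1{2N+1}\sum_{j=-N}^{N}u_je^{-2\pi i \frac{kj}{2N+1}}.$$ *)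

theory Defs
  imports "HOL-Analysis.Analysis"
begin

(* A function on the torus is represented by a function on the reals of which only the
   values on the grid matter; u_j stands for u (h * j). *)

definition discrete_torus :: "real \<Rightarrow> nat \<Rightarrow> real set" where
  "discrete_torus h N = (\<lambda>j::int. h * of_int j) ` {- int N..int N}"

definition fourier_coeff :: "real \<Rightarrow> nat \<Rightarrow> (real \<Rightarrow> complex) \<Rightarrow> int \<Rightarrow> complex" where
  "fourier_coeff h N u k =
     1 / of_nat (2 * N + 1) *
     (\<Sum>j = - int N..int N.
        u (h * of_int j) * exp (- 2 * of_real pi * \<i> * of_int (k * j) / of_nat (2 * N + 1)))"

(* The value at the grid point h * j. At k = 0 the multiplier is 0 powr s = 0. *)

definition frac_laplacian :: "real \<Rightarrow> nat \<Rightarrow> real \<Rightarrow> (real \<Rightarrow> complex) \<Rightarrow> int \<Rightarrow> complex" where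
  "frac_laplacian h N s u j =
     (\<Sum>k = - int N..int N.
        of_real ((4 / h\<^sup>2 * (sin (of_int k * pi / of_nat (2 * N + 1)))\<^sup>2) powr s) *
        fourier_coeff h N u k *
        exp (\<i> * of_int k * (2 * of_real pi * of_int j / of_nat (2 * N + 1))))"

end

theory Submission
  imports Defs
begin

text \<open>
  The proof counts dimensions. Functions on the grid that vanish on the \<open>M\<close> points of \<open>X\<close> form
  a real vector space of dimension \<open>2 * N + 1 - M\<close>, and asking that the fractional Laplacian vanish
  at those \<open>M\<close> points imposes \<open>M\<close> further linear conditions. Since \<open>M < 2 * N + 1 - M\<close> is the
  same as \<open>M \<le> N\<close>, a non-zero solution remains
  (\<open>underdetermined_system_nontrivial_solution\<close>).

  The count has to be carried out over the reals, because \<open>u\<close> is real. A priori each complex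
  equation is worth two real ones, but the fractional Laplacian is a convolution with a real kernel:
  its Fourier multiplier is real and even in the frequency
  (\<open>frac_laplacian_eq_kernel_sum\<close>, \<open>frac_kernel_real\<close>).
\<close>

text \<open>
  Gaussian elimination: an equation with a non-zero coefficient determines one unknown through the
  others, so removing the equation and substituting costs exactly one unknown and keeps the surplus.
\<close>

lemma underdetermined_system_nontrivial_solution:
  fixes a :: "'e \<Rightarrow> 'i \<Rightarrow> 'f::field"
  assumes "finite E" "finite I" "card E < card I"
  shows "\<exists>x. (\<exists>i\<in>I. x i \<noteq> 0) \<and> (\<forall>e\<in>E. (\<Sum>i\<in>I. a e i * x i) = 0)"
  using assms
proof (induction E arbitrary: I a rule: finite_induct)
  case empty
  then obtain i where "i \<in> I" by fastforce
  then show ?case by (intro exI[of _ "\<lambda>_. 1"]) auto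
next
  case (insert e E)
  show ?case
  proof (cases "\<forall>i\<in>I. a e i = 0")
    case True
    obtain x where "\<exists>i\<in>I. x i \<noteq> 0" "\<forall>f\<in>E. (\<Sum>i\<in>I. a f i * x i) = 0"
      using insert.IH[of I a] insert.prems insert.hyps by auto
    with True show ?thesis by (intro exI[of _ x]) auto
  next
    case False
    then obtain p where p: "p \<in> I" "a e p \<noteq> 0" by auto
    define J where "J = I - {p}"
    have J: "finite J" "p \<notin> J" "I = insert p J"
      using p insert.prems by (auto simp: J_def)
    have "card E < card J"
      using insert.prems insert.hyps J by simp
    then obtain y where y: "\<exists>i\<in>J. y i \<noteq> 0"
        "\<forall>f\<in>E. (\<Sum>i\<in>J. (a f i - a f p * a e i / a e p) * y i) = 0"
      using insert.IH[of J "\<lambda>f i. a f i - a f p * a e i / a e p"] J by auto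
    \<comment> \<open>The value at the pivot is the one that equation \<open>e\<close> forces.\<close>
    define x where "x = y(p := - (\<Sum>i\<in>J. a e i * y i) / a e p)"
    have sum_x: "(\<Sum>i\<in>I. a f i * x i) =
        (\<Sum>i\<in>J. a f i * y i) - a f p * (\<Sum>i\<in>J. a e i * y i) / a e p" for f
    proof -
      have "(\<Sum>i\<in>J. a f i * x i) = (\<Sum>i\<in>J. a f i * y i)"
        using J by (intro sum.cong) (auto simp: x_def)
      then show ?thesis using J by (simp add: x_def)
    qed
    have "(\<Sum>i\<in>I. a f i * x i) = 0" if "f \<in> E" for f
    proof -
      have "(\<Sum>i\<in>J. (a f i - a f p * a e i / a e p) * y i) =
          (\<Sum>i\<in>J. a f i * y i) - a f p * (\<Sum>i\<in>J. a e i * y i) / a e p"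
        by (simp add: left_diff_distrib sum_subtractf sum_distrib_left sum_divide_distrib mult.assoc)
      with y(2) that show ?thesis by (simp add: sum_x)
    qed
    moreover have "(\<Sum>i\<in>I. a e i * x i) = 0"
      using p by (simp add: sum_x)
    moreover have "\<exists>i\<in>I. x i \<noteq> 0"
      using y(1) J by (auto simp: x_def)
    ultimately show ?thesis by (intro exI[of _ x]) auto
  qed
qed

definition frac_kernel :: "real \<Rightarrow> nat \<Rightarrow> real \<Rightarrow> int \<Rightarrow> int \<Rightarrow> complex" where
  "frac_kernel h N s j l =
     (\<Sum>k = - int N..int N.
        of_real ((4 / h\<^sup>2 * (sin (of_int k * pi / of_nat (2 * N + 1)))\<^sup>2) powr s) /
        of_nat (2 * N + 1) *
        exp (\<i> * of_real (2 * pi * of_int (k * (j - l)) / of_nat (2 * N + 1))))"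

lemma frac_laplacian_eq_kernel_sum:
  "frac_laplacian h N s u j = (\<Sum>l = - int N..int N. frac_kernel h N s j l * u (h * of_int l))"
proof -
  define n :: complex where "n = of_nat (2 * N + 1)"
  define m where "m k = complex_of_real
      ((4 / h\<^sup>2 * (sin (of_int k * pi / of_nat (2 * N + 1)))\<^sup>2) powr s)" for k :: int
  have phase: "exp (- 2 * of_real pi * \<i> * of_int (k * l) / n) *
        exp (\<i> * of_int k * (2 * of_real pi * of_int j / n)) =
      exp (\<i> * of_real (2 * pi * of_int (k * (j - l)) / of_nat (2 * N + 1)))" for k l
    unfolding exp_add[symmetric] n_def
    by (rule arg_cong[of _ _ exp]) (simp add: diff_divide_distrib right_diff_distrib mult_ac)
  have "frac_laplacian h N s u j =
      (\<Sum>k = - int N..int N. \<Sum>l = - int N..int N. m k / n *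
        (exp (- 2 * of_real pi * \<i> * of_int (k * l) / n) *
         exp (\<i> * of_int k * (2 * of_real pi * of_int j / n))) * u (h * of_int l))"
    unfolding frac_laplacian_def fourier_coeff_def m_def[symmetric] n_def[symmetric]
    by (simp add: sum_distrib_left sum_distrib_right sum_divide_distrib mult_ac)
  also have "\<dots> = (\<Sum>l = - int N..int N. \<Sum>k = - int N..int N. m k / n *
        exp (\<i> * of_real (2 * pi * of_int (k * (j - l)) / of_nat (2 * N + 1))) * u (h * of_int l))"
    unfolding phase by (rule sum.swap)
  finally show ?thesis
    unfolding frac_kernel_def m_def[symmetric] n_def[symmetric] by (simp only: sum_distrib_right)
qed

text \<open>
  Conjugation turns the mode \<open>k\<close> into the mode \<open>- k\<close>. The squared sine gives both the same
  multiplier, and the frequency window is symmetric, so the sum is its own conjugate.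
\<close>

lemma frac_kernel_real: "frac_kernel h N s j l \<in> \<real>"
proof -
  have "cnj (frac_kernel h N s j l) = frac_kernel h N s j l"
    unfolding frac_kernel_def cnj_sum
    by (rule sum.reindex_bij_witness[of _ uminus uminus]) (auto simp: exp_cnj)
  then show ?thesis by (simp add: Reals_cnj_iff)
qed

theorem theorem9:
  fixes s h :: real and N M :: nat and X :: "real set"
  assumes "0 < s" and "s < 1" and "0 < h"
    and "X \<subseteq> discrete_torus h N" and "finite X" and "card X = M"
    and "M \<le> 2 * N + 1" and "M \<le> N"
  shows "\<exists>u :: real \<Rightarrow> real.
           (\<exists>x \<in> discrete_torus h N. u x \<noteq> 0) \<and>
           bounded (u ` discrete_torus h N) \<and>
           (\<forall>j \<in> {- int N..int N}. h * of_int j \<in> X \<longrightarrow>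
              u (h * of_int j) = 0 \<and>
              frac_laplacian h N s (\<lambda>x. complex_of_real (u x)) j = 0)"
proof -
  define G where "G = {- int N..int N}"
  define E where "E = G \<inter> {j. h * of_int j \<in> X}"
  have fin: "finite G" "finite E" by (simp_all add: G_def E_def)
  have E_sub: "E \<subseteq> G" and card_G: "card G = 2 * N + 1"
    by (auto simp: E_def G_def)
  have "X = (\<lambda>j. h * of_int j) ` E"
    using \<open>X \<subseteq> discrete_torus h N\<close> by (auto simp: discrete_torus_def E_def G_def)
  moreover have "inj_on (\<lambda>j::int. h * of_int j) E"
    using \<open>0 < h\<close> by (auto simp: inj_on_def)
  ultimately have "card E = M"
    using \<open>card X = M\<close> by (simp add: card_image)
  moreover have "card (G - E) = 2 * N + 1 - card E"
    using fin by (simp add: card_Diff_subset[of E G] E_sub card_G)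
  ultimately have "card E < card (G - E)"
    using \<open>M \<le> N\<close> by simp
  then obtain x where x: "\<exists>i\<in>G - E. x i \<noteq> 0"
      "\<forall>j\<in>E. (\<Sum>l\<in>G - E. Re (frac_kernel h N s j l) * x l) = 0"
    using underdetermined_system_nontrivial_solution
      [of E "G - E" "\<lambda>j l. Re (frac_kernel h N s j l)"] fin by auto
  \<comment> \<open>On the grid, \<open>\<lfloor>t / h\<rfloor>\<close> recovers the index of the point \<open>t\<close>.\<close>
  define u where "u t = (if \<lfloor>t / h\<rfloor> \<in> E then 0 else x \<lfloor>t / h\<rfloor>)" for t
  have u: "u (h * of_int j) = (if j \<in> E then 0 else x j)" for j
    using \<open>0 < h\<close> by (simp add: u_def)
  have "frac_laplacian h N s (\<lambda>t. complex_of_real (u t)) j = 0" if "j \<in> E" for j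
  proof -
    have "frac_laplacian h N s (\<lambda>t. complex_of_real (u t)) j =
        (\<Sum>l\<in>G. of_real (Re (frac_kernel h N s j l) * u (h * of_int l)))"
      unfolding frac_laplacian_eq_kernel_sum G_def
      by (intro sum.cong) (simp_all add: frac_kernel_real)
    also have "\<dots> = of_real (\<Sum>l\<in>G - E. Re (frac_kernel h N s j l) * x l)"
      unfolding of_real_sum using fin by (intro sum.mono_neutral_cong_right) (auto simp: u)
    finally show ?thesis using x(2) that by simp
  qed
  moreover have "\<exists>t \<in> discrete_torus h N. u t \<noteq> 0"
    using x(1) by (auto simp: discrete_torus_def G_def[symmetric] u)
  moreover have "bounded (u ` discrete_torus h N)"
    by (intro finite_imp_bounded finite_imageI) (simp add: discrete_torus_def)
  ultimately show ?thesis
    by (intro exI[of _ u]) (auto simp: u E_def G_def)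
qed

end
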